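(* Let $(M,d)$ be a continuous metric space, let $n\ge1$, let $\boldsymbol{\ell}=(\ell_1,\dots,\ell_n)\in M^n$ be the true locations of the agents, and let $\hat o\in M$ be a prediction that is $\gamma$-accurate, i.e. $\frac{\mathrm{SC}(\hat o,\boldsymbol\ell)}{\mathrm{opt}(\boldsymbol\ell)}\le\gamma$. Let $a=\frac1n\mathrm{SC}(\hat o,\boldsymbol\ell)$ be the average cost of the prediction, let $\Delta\ge 0$, and let $c=\Delta/a$. Then $\mathrm{Harmonic}(\Delta)$ is $\gamma(1+2c)$-consistent: for every Pure Nash Equilibrium $\tilde{\boldsymbol\ell}$ of the game induced by $\mathrm{Harmonic}(\Delta)$ with prediction $\hat o$, the expected social cost satisfies $$\mathbb{E}\big[\mathrm{SC}(f(\tilde{\boldsymbol\ell},\hat o),\boldsymbol\ell)\big]\le \gamma\,(1+2c)\cdot\mathrm{opt}(\boldsymbol\ell).$$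
   Context: A metric space $(M,d)$ is called continuous if for any two points $P_1,P_2\in M$ and any $x\in[0,d(P_1,P_2)]$ there exists a point $P\in M$ with $d(P,P_1)=x$ and $d(P,P_2)=d(P_1,P_2)-x$. The social cost of placing the facility at $f\in M$ is $\mathrm{SC}(f,\boldsymbol\ell)=\sum_{i\in[n]}d(f,\ell_i)$, and $\mathrm{opt}(\boldsymbol\ell)=\min_{o'\in M}\mathrm{SC}(o',\boldsymbol\ell)$. The ratios $\mathrm{SC}(\hat o,\boldsymbol\ell)/\mathrm{opt}(\boldsymbol\ell)$ and $\Delta/a$ are understood to have nonzero denominators. Mechanism $\mathrm{Harmonic}(\Delta)$: given reports $\tilde{\boldsymbol\ell}=(\tilde\ell_1,\dots,\tilde\ell_n)\in M^n$ and the prediction $\hat o$, the (random) facility $f(\tilde{\boldsymbol\ell},\hat o)$ is placed at $\tilde\ell_j$ with probability $$\frac{1/(d(\tilde\ell_j,\hat o)+\Delta)}{\sum_{k=1}^n 1/(d(\tilde\ell_k,\hat o)+\Delta)},\qquad j\in[n].$$ (No separate convention is stated for the case $\Delta=0$ with a report equal to $\hat o$.) In the induced game each agent $i$ chooses a report $\tilde\ell_i\in M$, and the cost of agent $i$ is $\mathrm{cost}_i(\tilde{\boldsymbol\ell})=\mathbb{E}[d(f(\tilde{\boldsymbol\ell},\hat o),\ell_i)]$. A Pure Nash Equilibrium is a profile $\tilde{\boldsymbol\ell}\in M^n$ such that $\mathrm{cost}_i(\tilde{\boldsymbol\ell})\le \mathrm{cost}_i(\tilde\ell_i',\tilde{\boldsymbol\ell}_{-i})$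 for every $i\in[n]$ and every $\tilde\ell_i'\in M$. *)

theory Defs
  imports "HOL-Probability.Probability"
begin

text \<open>The metric space is a type of class \<^class>\<open>metric_space\<close>. The agents are \<open>0, \<dots>, n - 1\<close>, and a
  profile in \<open>M\<^sup>n\<close> is a function on \<^typ>\<open>nat\<close>, of which only the values below \<open>n\<close> are used.\<close>

definition continuous_metric_space :: "'a::metric_space itself \<Rightarrow> bool" where
  "continuous_metric_space (T :: 'a itself) \<longleftrightarrow>
     (\<forall>(P1::'a) (P2::'a) (x::real). 0 \<le> x \<and> x \<le> dist P1 P2 \<longrightarrow>
        (\<exists>P::'a. dist P P1 = x \<and> dist P P2 = dist P1 P2 - x))"

definition social_cost :: "nat \<Rightarrow> (nat \<Rightarrow> 'a::metric_space) \<Rightarrow> 'a \<Rightarrow> real" where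
  "social_cost n l f = (\<Sum>i<n. dist f (l i))"

text \<open>The infimum is the minimum whenever the latter is attained. It always exists, since the social
  cost is bounded below by \<open>0\<close>.\<close>

definition opt_cost :: "nat \<Rightarrow> (nat \<Rightarrow> 'a::metric_space) \<Rightarrow> real" where
  "opt_cost n l = (INF x. social_cost n l x)"

definition accurate :: "nat \<Rightarrow> (nat \<Rightarrow> 'a::metric_space) \<Rightarrow> real \<Rightarrow> 'a \<Rightarrow> bool" where
  "accurate n l \<gamma> p \<longleftrightarrow> social_cost n l p / opt_cost n l \<le> \<gamma>"

text \<open>A mechanism maps the reports and the prediction to the distribution of the facility.\<close>

type_synonym 'a mechanism = "(nat \<Rightarrow> 'a) \<Rightarrow> 'a \<Rightarrow> 'a pmf"

definition agent_cost ::
  "('a::metric_space) mechanism \<Rightarrow> 'a \<Rightarrow> (nat \<Rightarrow> 'a) \<Rightarrow> (nat \<Rightarrow> 'a) \<Rightarrow> nat \<Rightarrow> real" where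
  "agent_cost F p l r i = measure_pmf.expectation (F r p) (\<lambda>x. dist x (l i))"

definition pure_nash ::
  "nat \<Rightarrow> ('a::metric_space) mechanism \<Rightarrow> 'a \<Rightarrow> (nat \<Rightarrow> 'a) \<Rightarrow> (nat \<Rightarrow> 'a) \<Rightarrow> bool" where
  "pure_nash n F p l r \<longleftrightarrow>
     (\<forall>i<n. \<forall>x. agent_cost F p l r i \<le> agent_cost F p l (r(i := x)) i)"

text \<open>The probability of selecting the report of agent \<open>j\<close>. If \<open>\<Delta> = 0\<close> and some report equals the
  prediction \<open>p\<close>, the harmonic formula reads \<open>\<infinity>/\<infinity>\<close> (and would be \<open>0\<close> in HOL, by \<open>1 / 0 = 0\<close>). The first
  branch takes its limit for \<open>\<Delta>\<close> tending to \<open>0\<close> from above, which is the uniform distribution on the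
  agents reporting \<open>p\<close>; the facility is then placed at \<open>p\<close>.\<close>

definition harmonic_prob ::
  "nat \<Rightarrow> real \<Rightarrow> (nat \<Rightarrow> 'a::metric_space) \<Rightarrow> 'a \<Rightarrow> nat \<Rightarrow> real" where
  "harmonic_prob n \<Delta> r p j =
     (if \<not> j < n then 0
      else if \<Delta> = 0 \<and> (\<exists>k<n. r k = p)
      then (if r j = p then 1 / real (card {k. k < n \<and> r k = p}) else 0)
      else (1 / (dist (r j) p + \<Delta>)) / (\<Sum>k<n. 1 / (dist (r k) p + \<Delta>)))"

definition harmonic :: "nat \<Rightarrow> real \<Rightarrow> ('a::metric_space) mechanism" where
  "harmonic n \<Delta> r p = map_pmf r (embed_pmf (harmonic_prob n \<Delta> r p))"

text \<open>\<^const>\<open>harmonic_prob\<close> is a probability mass function, so \<^const>\<open>embed_pmf\<close> is meaningful in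
  \<^const>\<open>harmonic\<close>.\<close>

lemma harmonic_prob_nonneg:
  assumes "0 \<le> \<Delta>"
  shows "0 \<le> harmonic_prob n \<Delta> r p j"
  using assms unfolding harmonic_prob_def
  by (auto simp del: divide_divide_eq_left divide_divide_eq_left'
      intro!: divide_nonneg_nonneg sum_nonneg)

lemma harmonic_prob_sum:
  assumes "1 \<le> n" and "0 \<le> \<Delta>"
  shows "(\<Sum>j<n. harmonic_prob n \<Delta> r p j) = 1"
proof (cases "\<Delta> = 0 \<and> (\<exists>k<n. r k = p)")
  case True
  let ?A = "{k. k < n \<and> r k = p}"
  have "?A \<noteq> {}" using True by auto
  then have card: "card ?A \<noteq> 0" by simp
  have "(\<Sum>j<n. harmonic_prob n \<Delta> r p j) = (\<Sum>j<n. if r j = p then 1 / real (card ?A) else 0)"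
    using True by (intro sum.cong) (auto simp: harmonic_prob_def)
  also have "\<dots> = (\<Sum>j\<in>?A. 1 / real (card ?A))"
    by (simp add: sum.If_cases lessThan_def Collect_conj_eq)
  also have "\<dots> = 1" using card by simp
  finally show ?thesis .
next
  case False
  let ?w = "\<lambda>k. 1 / (dist (r k) p + \<Delta>)"
  have pos: "0 < ?w k" if "k < n" for k
  proof -
    have "0 < dist (r k) p + \<Delta>"
      using False assms(2) that
      by (metis add.right_neutral add_nonneg_pos add_pos_nonneg order_le_less zero_le_dist zero_less_dist_iff)
    then show ?thesis by simp
  qed
  have "0 < (\<Sum>k<n. ?w k)"
    using assms(1) pos by (intro sum_pos) (auto simp: lessThan_empty_iff)
  moreover have "(\<Sum>j<n. harmonic_prob n \<Delta> r p j) = (\<Sum>j<n. ?w j / (\<Sum>k<n. ?w k))"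
    using False by (intro sum.cong) (auto simp: harmonic_prob_def)
  moreover have "\<dots> = (\<Sum>j<n. ?w j) / (\<Sum>k<n. ?w k)"
    by (rule sum_divide_distrib [symmetric])
  ultimately show ?thesis by simp
qed

lemma pmf_embed_harmonic_prob:
  assumes "1 \<le> n" and "0 \<le> \<Delta>"
  shows "pmf (embed_pmf (harmonic_prob n \<Delta> r p)) j = harmonic_prob n \<Delta> r p j"
proof (rule pmf_embed_pmf)
  show "0 \<le> harmonic_prob n \<Delta> r p k" for k
    using assms(2) by (rule harmonic_prob_nonneg)
  have "(\<integral>\<^sup>+k. ennreal (harmonic_prob n \<Delta> r p k) \<partial>count_space UNIV) =
      (\<Sum>k<n. ennreal (harmonic_prob n \<Delta> r p k))"
    by (rule nn_integral_count_space') (auto simp: harmonic_prob_def)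
  also have "\<dots> = 1"
    using assms by (simp add: sum_ennreal harmonic_prob_nonneg harmonic_prob_sum)
  finally show "(\<integral>\<^sup>+k. ennreal (harmonic_prob n \<Delta> r p k) \<partial>count_space UNIV) = 1" .
qed

end

(* At an equilibrium, deviating to the true location and to the prediction p shows that every agent
   whose expected cost exceeds dist p (l i) + \<Delta> must report p. If k > 0 agents report p, the weights
   1 / (dist (r j) p + \<Delta>) add up to at least k / \<Delta>, and the triangle inequality through p bounds the
   excess of every agent's cost over dist p (l i) by n \<Delta> / k - \<Delta>. The total excess is therefore at most
   (n - k) \<Delta> + k (n \<Delta> / k - \<Delta>) \<le> 2 n \<Delta>, and n \<Delta> = c * social_cost n l p. *)

theory Submission imports Defs begin

lemma expectation_harmonic:
  fixes g :: "'a::metric_space \<Rightarrow> real"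
  assumes "1 \<le> n" "0 \<le> \<Delta>"
  shows "measure_pmf.expectation (harmonic n \<Delta> r p) g
           = (\<Sum>j<n. harmonic_prob n \<Delta> r p j * g (r j))"
proof -
  let ?q = "embed_pmf (harmonic_prob n \<Delta> r p)"
  have "set_pmf ?q \<subseteq> {..<n}"
    using assms by (auto simp: set_pmf_eq pmf_embed_harmonic_prob harmonic_prob_def)
  then have "measure_pmf.expectation ?q (\<lambda>j. g (r j)) = (\<Sum>j<n. g (r j) * pmf ?q j)"
    by (intro integral_measure_pmf_real) auto
  then show ?thesis
    using assms by (simp add: harmonic_def integral_map_pmf pmf_embed_harmonic_prob mult.commute)
qed

lemma expectation_harmonic_pos:
  fixes g :: "'a::metric_space \<Rightarrow> real"
  assumes "1 \<le> n" "0 < \<Delta>"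
  shows "measure_pmf.expectation (harmonic n \<Delta> r p) g
           = (\<Sum>j<n. g (r j) / (dist (r j) p + \<Delta>)) / (\<Sum>j<n. 1 / (dist (r j) p + \<Delta>))"
  unfolding expectation_harmonic[OF assms(1) less_imp_le[OF assms(2)]] sum_divide_distrib
  by (rule sum.cong) (use assms in \<open>auto simp: harmonic_prob_def\<close>)

text \<open>By the limit convention in \<open>harmonic_prob\<close>, all the mass lies on agents
  reporting \<open>p\<close>, so replacing \<open>g (r j)\<close> by \<open>g p\<close> changes no
  term of the sum.\<close>

lemma expectation_harmonic_zero:
  fixes g :: "'a::metric_space \<Rightarrow> real"
  assumes "1 \<le> n" "k < n" "r k = p"
  shows "measure_pmf.expectation (harmonic n 0 r p) g = g p"
proof -
  have "measure_pmf.expectation (harmonic n 0 r p) g = (\<Sum>j<n. harmonic_prob n 0 r p j * g p)"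
    using assms unfolding expectation_harmonic[OF assms(1) order_refl]
    by (intro sum.cong) (auto simp: harmonic_prob_def)
  then show ?thesis
    using assms by (simp add: harmonic_prob_sum flip: sum_distrib_right)
qed

lemma expectation_social_cost_harmonic:
  assumes "1 \<le> n" "0 \<le> \<Delta>"
  shows "measure_pmf.expectation (harmonic n \<Delta> r p) (social_cost n l)
           = (\<Sum>i<n. agent_cost (harmonic n \<Delta>) p l r i)"
  unfolding agent_cost_def expectation_harmonic[OF assms] social_cost_def sum_distrib_left
  by (rule sum.swap)

text \<open>Numerator and denominator of the harmonic average are multiplied by
  \<open>dist x p + \<Delta>\<close>. Since \<open>A\<close> and \<open>B\<close> do not depend on
  \<open>x\<close>, the costs of different deviations of agent \<open>i\<close> become directly
  comparable.\<close>

lemma agent_cost_harmonic_upd: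
  fixes p :: "'a::metric_space" and l r :: "nat \<Rightarrow> 'a"
  assumes "i < n" "0 < \<Delta>"
  defines "A \<equiv> \<Sum>j\<in>{..<n} - {i}. dist (r j) (l i) / (dist (r j) p + \<Delta>)"
    and "B \<equiv> \<Sum>j\<in>{..<n} - {i}. 1 / (dist (r j) p + \<Delta>)"
  shows "agent_cost (harmonic n \<Delta>) p l (r(i := x)) i
           = (A * (dist x p + \<Delta>) + dist x (l i)) / (B * (dist x p + \<Delta>) + 1)"
proof -
  have n: "1 \<le> n" and i: "i \<in> {..<n}" and w: "0 < dist x p + \<Delta>"
    using assms(1,2) by (auto intro: add_nonneg_pos)
  have "agent_cost (harmonic n \<Delta>) p l (r(i := x)) i
      = (dist x (l i) / (dist x p + \<Delta>) + A) / (1 / (dist x p + \<Delta>) + B)"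
    unfolding agent_cost_def expectation_harmonic_pos[OF n assms(2)] A_def B_def
    by (simp add: sum.remove[OF finite_lessThan i])
  also have "\<dots> = ((dist x (l i) / (dist x p + \<Delta>) + A) * (dist x p + \<Delta>))
      / ((1 / (dist x p + \<Delta>) + B) * (dist x p + \<Delta>))"
    using w by simp
  also have "\<dots> = (A * (dist x p + \<Delta>) + dist x (l i)) / (B * (dist x p + \<Delta>) + 1)"
    using w by (simp add: distrib_right add.commute)
  finally show ?thesis .
qed

text \<open>Failing to profit from reporting \<open>l i\<close> forces \<open>A\<close> to be large:
  the other reports are costly for agent \<open>i\<close>. The agent then wants the greatest
  possible weight on its own report, and reporting \<open>p\<close> strictly beats any report at
  distance \<open>t > 0\<close> from \<open>p\<close>.\<close>

lemma pure_nash_harmonic_report: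
  fixes p :: "'a::metric_space"
  assumes nash: "pure_nash n (harmonic n \<Delta>) p l r" and "i < n" "0 < \<Delta>"
    and large: "dist p (l i) + \<Delta> < agent_cost (harmonic n \<Delta>) p l r i"
  shows "r i = p"
proof (rule ccontr)
  assume "r i \<noteq> p"
  define A where "A = (\<Sum>j\<in>{..<n} - {i}. dist (r j) (l i) / (dist (r j) p + \<Delta>))"
  define B where "B = (\<Sum>j\<in>{..<n} - {i}. 1 / (dist (r j) p + \<Delta>))"
  define C where "C = agent_cost (harmonic n \<Delta>) p l r i"
  define d where "d = dist p (l i)"
  define t where "t = dist (r i) p"
  note upd = agent_cost_harmonic_upd[OF \<open>i < n\<close> \<open>0 < \<Delta>\<close>, where l = l and r = r and p = p, folded A_def B_def]
  have B: "0 \<le> B" unfolding B_def using \<open>0 < \<Delta>\<close> by (auto intro!: sum_nonneg)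
  have d: "0 \<le> d" and t: "0 < t" using \<open>r i \<noteq> p\<close> by (auto simp: d_def t_def)
  have dev: "C \<le> agent_cost (harmonic n \<Delta>) p l (r(i := x)) i" for x
    using nash \<open>i < n\<close> unfolding pure_nash_def C_def by blast
  \<comment> \<open>Reporting \<open>l i\<close> makes the own-distance term vanish and puts the
    report at distance \<open>d\<close> from \<open>p\<close>.\<close>
  have "d + \<Delta> < A * (d + \<Delta>) / (B * (d + \<Delta>) + 1)"
    using large dev[of "l i"] by (simp add: upd C_def d_def dist_commute)
  then have "(d + \<Delta>) * (B * (d + \<Delta>) + 1) < (d + \<Delta>) * A"
    using B d \<open>0 < \<Delta>\<close> by (subst (asm) pos_less_divide_eq) (auto intro!: add_nonneg_pos simp: mult.commute)
  then have A: "B * (d + \<Delta>) + 1 < A"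
    using d \<open>0 < \<Delta>\<close> by (subst (asm) mult_less_cancel_left_pos) auto
  \<comment> \<open>A report at distance \<open>t\<close> from \<open>p\<close> is at most
    \<open>t\<close> closer to \<open>l i\<close> than \<open>p\<close> is, so the current cost has
    a lower bound depending on the report only through \<open>t\<close>.\<close>
  have "d - t \<le> dist (r i) (l i)"
    using dist_triangle[of p "l i" "r i"] by (simp add: d_def t_def dist_commute)
  then have "(A * (t + \<Delta>) + (d - t)) / (B * (t + \<Delta>) + 1)
      \<le> (A * (t + \<Delta>) + dist (r i) (l i)) / (B * (t + \<Delta>) + 1)"
    using B t \<open>0 < \<Delta>\<close> by (intro divide_right_mono) auto
  also have "\<dots> = C"
    using upd[of "r i"] by (simp add: C_def t_def)
  also have "\<dots> \<le> (A * \<Delta> + d) / (B * \<Delta> + 1)"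
    using dev[of p] by (simp add: upd d_def)
  finally have "(A * (t + \<Delta>) + (d - t)) / (B * (t + \<Delta>) + 1) \<le> (A * \<Delta> + d) / (B * \<Delta> + 1)" .
  moreover have "0 < B * (t + \<Delta>) + 1" "0 < B * \<Delta> + 1"
    using B t \<open>0 < \<Delta>\<close> by (simp_all add: add_nonneg_pos)
  ultimately have "(A * (t + \<Delta>) + (d - t)) * (B * \<Delta> + 1) \<le> (A * \<Delta> + d) * (B * (t + \<Delta>) + 1)"
    by (simp only: pos_divide_le_eq pos_le_divide_eq times_divide_eq_left)
  \<comment> \<open>The difference of the cross products factors exactly into \<open>t\<close> and
    the slack of the inequality \<open>A\<close>, both positive.\<close>
  then have "t * (A - (B * (d + \<Delta>) + 1)) \<le> 0" by (simp add: algebra_simps)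
  with t A show False by (simp add: mult_le_0_iff)
qed

lemma agent_cost_harmonic_triangle:
  fixes p :: "'a::metric_space"
  assumes "1 \<le> n" "0 < \<Delta>"
  shows "agent_cost (harmonic n \<Delta>) p l r i
           \<le> dist p (l i) + n / (\<Sum>j<n. 1 / (dist (r j) p + \<Delta>)) - \<Delta>"
proof -
  define W where "W = (\<Sum>j<n. 1 / (dist (r j) p + \<Delta>))"
  have w: "0 < dist (r j) p + \<Delta>" for j using assms(2) by (simp add: add_nonneg_pos)
  have W: "0 < W" unfolding W_def using assms w by (intro sum_pos) (auto simp: lessThan_empty_iff)
  \<comment> \<open>The triangle bound is split as
    \<open>(dist (r j) p + \<Delta>) + (dist p (l i) - \<Delta>)\<close>: the first summand cancels
    the weight and yields 1 per agent, hence \<open>n / W\<close> after normalization.\<close>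
  have "(\<Sum>j<n. dist (r j) (l i) / (dist (r j) p + \<Delta>))
      \<le> (\<Sum>j<n. 1 + (dist p (l i) - \<Delta>) * (1 / (dist (r j) p + \<Delta>)))"
  proof (rule sum_mono)
    fix j
    show "dist (r j) (l i) / (dist (r j) p + \<Delta>)
        \<le> 1 + (dist p (l i) - \<Delta>) * (1 / (dist (r j) p + \<Delta>))"
      using w[of j] dist_triangle[of "r j" "l i" p] by (simp add: pos_divide_le_eq distrib_right)
  qed
  also have "\<dots> = n + (dist p (l i) - \<Delta>) * W"
    by (simp only: sum.distrib W_def sum_distrib_left) simp
  finally have "agent_cost (harmonic n \<Delta>) p l r i \<le> (n + (dist p (l i) - \<Delta>) * W) / W"
    unfolding agent_cost_def expectation_harmonic_pos[OF assms]
    using W by (fold W_def) (intro divide_right_mono, auto)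
  also have "\<dots> = dist p (l i) + n / W - \<Delta>"
    using W by (simp add: add_divide_distrib)
  finally show ?thesis by (simp add: W_def)
qed

lemma pure_nash_harmonic_social_cost:
  fixes p :: "'a::metric_space"
  assumes nash: "pure_nash n (harmonic n \<Delta>) p l r" and n: "1 \<le> n" and "0 \<le> \<Delta>"
  shows "measure_pmf.expectation (harmonic n \<Delta> r p) (social_cost n l)
           \<le> social_cost n l p + 2 * real n * \<Delta>"
proof (cases "\<Delta> = 0")
  case True
  \<comment> \<open>For \<Delta> = 0 a single report at \<open>p\<close> puts the facility at
    \<open>p\<close> with certainty, so every agent can secure its distance to
    \<open>p\<close>.\<close>
  have "agent_cost (harmonic n \<Delta>) p l r i \<le> dist p (l i)" if i: "i < n" for i
  proof -
    have "agent_cost (harmonic n \<Delta>) p l r i \<le> agent_cost (harmonic n \<Delta>) p l (r(i := p)) i"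
      using nash i by (auto simp: pure_nash_def)
    also have "\<dots> = dist p (l i)"
      using True by (simp add: agent_cost_def expectation_harmonic_zero[OF n i])
    finally show ?thesis .
  qed
  then show ?thesis
    unfolding expectation_social_cost_harmonic[OF n \<open>0 \<le> \<Delta>\<close>] social_cost_def
    using True by (auto intro!: sum_mono)
next
  case False
  then have \<Delta>: "0 < \<Delta>" using \<open>0 \<le> \<Delta>\<close> by simp
  define K where "K = {k. k < n \<and> r k = p}"
  define W where "W = (\<Sum>j<n. 1 / (dist (r j) p + \<Delta>))"
  have K: "K \<subseteq> {..<n}" and fin: "finite K" by (auto simp: K_def)
  have "card K / \<Delta> = (\<Sum>j\<in>K. 1 / (dist (r j) p + \<Delta>))" by (simp add: K_def)
  also have "\<dots> \<le> W"
    unfolding W_def using K \<Delta> by (intro sum_mono2) auto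
  finally have W: "card K / \<Delta> \<le> W" .
  have excess: "(\<Sum>i\<in>K. n / W - \<Delta>) \<le> n * \<Delta>"
  proof (cases "K = {}")
    case False
    then have "0 < card K" using fin by (simp add: card_gt_0_iff)
    then have "0 < W" using W \<Delta> by (intro less_le_trans[OF _ W]) simp
    \<comment> \<open>The sum equals \<open>n * (card K / W) - card K * \<Delta>\<close>; the first
      term is at most \<open>n * \<Delta>\<close> and the subtracted one is dropped.\<close>
    then have "card K / W \<le> \<Delta>" using W \<Delta> by (simp add: field_simps)
    then have "n * (card K / W) \<le> n * \<Delta>" by (intro mult_left_mono) auto
    moreover have "0 \<le> card K * \<Delta>" using \<Delta> by simp
    ultimately show ?thesis by (simp add: algebra_simps)
  qed (use \<Delta> in auto)
  have "(\<Sum>i<n. agent_cost (harmonic n \<Delta>) p l r i)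
      \<le> (\<Sum>i<n. dist p (l i) + (if i \<in> K then n / W - \<Delta> else \<Delta>))"
  \<comment> \<open>Agents in \<open>K\<close> get the triangle bound; the others get excess at most
    \<Delta> by the contrapositive of \<open>pure_nash_harmonic_report\<close>.\<close>
  proof (rule sum_mono)
    fix i assume "i \<in> {..<n}"
    then show "agent_cost (harmonic n \<Delta>) p l r i
        \<le> dist p (l i) + (if i \<in> K then n / W - \<Delta> else \<Delta>)"
      using agent_cost_harmonic_triangle[OF n \<Delta>, of p l r i]
        pure_nash_harmonic_report[OF nash _ \<Delta>, of i]
      by (auto simp: W_def K_def not_less[symmetric])
  qed
  also have "\<dots> = social_cost n l p + ((\<Sum>i\<in>K. n / W - \<Delta>) + (\<Sum>i\<in>{..<n} - K. \<Delta>))"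
    using K by (simp only: sum.distrib social_cost_def sum.If_cases finite_lessThan)
      (simp add: Int_absorb1 Diff_eq Collect_mem_eq)
  \<comment> \<open>Each of the two groups contributes at most \<open>n * \<Delta>\<close>, which is
    the origin of the factor 2.\<close>
  also have "(\<Sum>i\<in>{..<n} - K. \<Delta>) \<le> (\<Sum>i<n. \<Delta>)"
    using \<Delta> by (intro sum_mono2) auto
  finally show ?thesis
    unfolding expectation_social_cost_harmonic[OF n \<open>0 \<le> \<Delta>\<close>]
    using excess by simp
qed

theorem theorem4p1:
  fixes n :: nat and l r :: "nat \<Rightarrow> 'a::metric_space" and p :: 'a and \<gamma> a \<Delta> c :: real
  assumes "continuous_metric_space TYPE('a)"
    and "n \<ge> 1"
    and "opt_cost n l \<noteq> 0"
    and "accurate n l \<gamma> p"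
    and "a = social_cost n l p / real n"
    and "a \<noteq> 0"
    and "\<Delta> \<ge> 0"
    and "c = \<Delta> / a"
    and "pure_nash n (harmonic n \<Delta>) p l r"
  shows "measure_pmf.expectation (harmonic n \<Delta> r p) (social_cost n l)
           \<le> \<gamma> * (1 + 2 * c) * opt_cost n l"
proof -
  have nonneg: "0 \<le> social_cost n l x" for x
    by (simp add: social_cost_def sum_nonneg)
  then have "0 \<le> opt_cost n l"
    unfolding opt_cost_def by (intro cINF_greatest) auto
  \<comment> \<open>The optimum is nonnegative and nonzero, hence positive, so the accuracy quotient
    can be cleared.\<close>
  then have opt: "social_cost n l p \<le> \<gamma> * opt_cost n l"
    using assms(3,4) by (simp add: accurate_def divide_le_eq)
  have "a \<ge> 0" using assms(5) nonneg[of p] by simp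
  then have c: "0 \<le> 1 + 2 * c" using assms(7,8) by simp
  have "measure_pmf.expectation (harmonic n \<Delta> r p) (social_cost n l)
      \<le> social_cost n l p + 2 * real n * \<Delta>"
    using assms(9,2,7) by (rule pure_nash_harmonic_social_cost)
  also have "\<dots> = social_cost n l p * (1 + 2 * c)"
  proof -
    have "social_cost n l p = a * n" "\<Delta> = a * c"
      using assms(2,5,6,8) by simp_all
    then show ?thesis by (simp add: algebra_simps)
  qed
  also have "\<dots> \<le> \<gamma> * opt_cost n l * (1 + 2 * c)"
    using opt c by (rule mult_right_mono)
  finally show ?thesis by (simp add: mult_ac)
qed

end
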